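(* For all integers $r\ge 2$ and all positive integers $n$, $a_n(FS_r)\le (r-1)^n\,(n+1)\,(n!)^2$.
   Context: $FS_r$ is the free semigroup of rank $r$, i.e. all non-empty words over an alphabet of $r$ letters under concatenation. The (Rees) index of a subsemigroup $T$ of a semigroup $S$ is $|S\setminus T|$, and $a_n(S)$ denotes the number of subsemigroups of $S$ of Rees index exactly $n$. *)

theory Defs
  imports Main
begin

definition free_semigroup :: "nat \<Rightarrow> nat list set" where
  "free_semigroup r = lists {..<r} - {[]}"

text \<open>
  A semigroup is given by a carrier \<open>S\<close> and a binary operation \<open>f\<close>.
  The empty set does not count as a subsemigroup; this is immaterial for subsemigroups of
  finite Rees index in an infinite semigroup.
\<close>

definition subsemigroup :: "('a \<Rightarrow> 'a \<Rightarrow> 'a) \<Rightarrow> 'a set \<Rightarrow> 'a set \<Rightarrow> bool" where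
  "subsemigroup f S T \<longleftrightarrow> T \<subseteq> S \<and> T \<noteq> {} \<and> (\<forall>x\<in>T. \<forall>y\<in>T. f x y \<in> T)"

definition subsemigroups_of_index ::
    "('a \<Rightarrow> 'a \<Rightarrow> 'a) \<Rightarrow> 'a set \<Rightarrow> nat \<Rightarrow> 'a set set" where
  "subsemigroups_of_index f S n = {T. subsemigroup f S T \<and> finite (S - T) \<and> card (S - T) = n}"

text \<open>
  As \<^const>\<open>card\<close> is 0 on infinite sets, the following is the number of subsemigroups of index
  \<open>n\<close> only if there are finitely many of them.
\<close>

definition num_subsemigroups_of_index ::
    "('a \<Rightarrow> 'a \<Rightarrow> 'a) \<Rightarrow> 'a set \<Rightarrow> nat \<Rightarrow> nat" where
  "num_subsemigroups_of_index f S n = card (subsemigroups_of_index f S n)"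

end

theory Submission
  imports Defs
begin

text \<open>
  Adding to a subsemigroup \<open>T\<close> of index \<open>n + 1\<close> a longest word \<open>w\<close> of its complement gives a
  subsemigroup of index \<open>n\<close> in which \<open>w\<close> is irreducible, so it suffices to bound the number of
  irreducibles of a subsemigroup with complement \<open>C\<close> of size \<open>n\<close>. Cut an irreducible \<open>w\<close> as
  \<open>u a v\<close>, where \<open>u a\<close> is the shortest nonempty prefix outside \<open>C\<close>; then \<open>v\<close> is empty or in \<open>C\<close>, as
  otherwise \<open>w\<close> would factor. The words \<open>u\<close> range over a subtree, with \<open>f \<le> n + 1\<close> vertices, of the
  \<open>r\<close>-ary tree, and \<open>u a\<close> over the \<open>(r - 1) f + 1\<close> vertices just outside of it. Thus there are
  at most \<open>((r - 1) (n + 1) + 1) (n + 1) \<le> (r - 1) (n + 1) (n + 2)\<close> irreducibles.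
\<close>

definition irreducibles :: "('a \<Rightarrow> 'a \<Rightarrow> 'a) \<Rightarrow> 'a set \<Rightarrow> 'a set" where
  "irreducibles f T = {w \<in> T. \<forall>x\<in>T. \<forall>y\<in>T. w \<noteq> f x y}"

text \<open>This is the largest prefix-closed subset of \<open>insert [] C\<close>: the subtree of
  words reachable from the root \<open>[]\<close> by adding letters at the end without leaving
  \<open>C\<close>.\<close>

definition prefix_core :: "'a list set \<Rightarrow> 'a list set" where
  "prefix_core C = {u. \<forall>j<length u. take (Suc j) u \<in> C}"

text \<open>A vertex just outside the tree \<open>F\<close> is encoded by the edge leading to it, as
  the pair of its parent and its last letter.\<close>

definition boundary_edges :: "'a set \<Rightarrow> 'a list set \<Rightarrow> ('a list \<times> 'a) set" where
  "boundary_edges A F = {(u, a). u \<in> F \<and> a \<in> A \<and> u @ [a] \<notin> F}"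

lemma Nil_in_prefix_core: "[] \<in> prefix_core C"
  by (simp add: prefix_core_def)

lemma prefix_core_subset: "prefix_core C \<subseteq> insert [] C"
proof
  fix u assume u: "u \<in> prefix_core C"
  show "u \<in> insert [] C"
  proof (cases u rule: rev_cases)
    case (snoc xs x)
    then have "take (Suc (length xs)) u \<in> C"
      using u by (auto simp: prefix_core_def simp del: take_Suc_Cons)
    then show ?thesis using snoc by simp
  qed simp
qed

lemma snoc_in_prefix_core_iff: "u @ [a] \<in> prefix_core C \<longleftrightarrow> u \<in> prefix_core C \<and> u @ [a] \<in> C"
  by (auto simp: prefix_core_def less_Suc_eq)

lemma finite_boundary_edges: "finite A \<Longrightarrow> finite F \<Longrightarrow> finite (boundary_edges A F)"
  by (rule finite_subset[of _ "F \<times> A"]) (auto simp: boundary_edges_def)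

text \<open>Of the \<open>card A * card F\<close> edges that start in \<open>F\<close>, those ending
  in \<open>F\<close> reach every vertex except the root, so there are at least
  \<open>card F - 1\<close> of them. The additive form avoids truncated subtraction.\<close>

lemma card_boundary_edges:
  assumes "finite A" "finite F" "F \<subseteq> lists A" "[] \<in> F"
    and closed: "\<And>u a. u @ [a] \<in> F \<Longrightarrow> u \<in> F"
  shows "card (boundary_edges A F) + card F \<le> card A * card F + 1"
proof -
  define I where "I = {(u, a). u \<in> F \<and> a \<in> A \<and> u @ [a] \<in> F}"
  have I: "finite I"
    by (rule finite_subset[of _ "F \<times> A"]) (use assms in \<open>auto simp: I_def\<close>)
  have "F - {[]} \<subseteq> (\<lambda>(u, a). u @ [a]) ` I"
  proof
    fix w assume w: "w \<in> F - {[]}"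
    then obtain u a where ua: "w = u @ [a]" by (cases w rule: rev_cases) auto
    then have "(u, a) \<in> I" using w closed assms(3) by (auto simp: I_def)
    then show "w \<in> (\<lambda>(u, a). u @ [a]) ` I" using ua by force
  qed
  then have 1: "card F - 1 \<le> card I"
    using surj_card_le[OF I] assms(2,4) by fastforce
  have "boundary_edges A F \<union> I = F \<times> A" "boundary_edges A F \<inter> I = {}"
    by (auto simp: boundary_edges_def I_def)
  then have "card (boundary_edges A F) + card I = card F * card A"
    using card_Un_disjoint[OF finite_boundary_edges[OF assms(1,2)] I] by (simp add: card_cartesian_product)
  then show ?thesis using 1 by (simp add: mult.commute)
qed

lemma irreducibles_subset:
  assumes "T \<subseteq> lists A - {[]}" and C: "C = lists A - {[]} - T"
  shows "irreducibles (@) T \<subseteq>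
    (\<lambda>((u, a), v). u @ a # v) ` (boundary_edges A (prefix_core C) \<times> insert [] C)"
proof
  fix w assume w: "w \<in> irreducibles (@) T"
  then have wT: "w \<in> T" and w': "\<And>x y. x \<in> T \<Longrightarrow> y \<in> T \<Longrightarrow> w \<noteq> x @ y"
    by (auto simp: irreducibles_def)
  then have wA: "w \<in> lists A" "w \<noteq> []" using assms by auto
  \<comment> \<open>This is the length of the prefix \<open>u\<close>. Testing \<open>Suc k\<close>
    letters skips the empty prefix, which is never in \<open>C\<close>.\<close>
  define k where "k = (LEAST k. take (Suc k) w \<notin> C)"
  have ex: "take (Suc (length w - 1)) w \<notin> C" using wT wA C by simp
  have k: "take (Suc k) w \<notin> C" unfolding k_def by (rule LeastI, rule ex)
  have min: "take (Suc j) w \<in> C" if "j < k" for j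
    using not_less_Least[of j "\<lambda>k. take (Suc k) w \<notin> C"] that by (auto simp: k_def)
  have "k \<le> length w - 1" unfolding k_def by (rule Least_le, rule ex)
  then have kl: "k < length w" using wA by (cases w) auto
  define u a v where "u = take k w" and "a = w ! k" and "v = drop (Suc k) w"
  have eq: "w = u @ a # v" and ua: "u @ [a] = take (Suc k) w"
    using kl by (simp_all add: u_def a_def v_def id_take_nth_drop[symmetric] take_Suc_conv_app_nth)
  have "u \<in> prefix_core C" using min by (auto simp: prefix_core_def u_def min_def)
  moreover have "a \<in> A" using wA eq by simp
  ultimately have 1: "(u, a) \<in> boundary_edges A (prefix_core C)"
    using k by (simp add: boundary_edges_def snoc_in_prefix_core_iff ua)
  have "u @ [a] \<in> lists A - {[]}" using wA eq by auto
  then have "u @ [a] \<in> T" using k ua C by simp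
  then have "v \<notin> T" using w'[of "u @ [a]" v] eq by auto
  then have "v \<in> insert [] C" using wA eq C by auto
  then show "w \<in> (\<lambda>((u, a), v). u @ a # v) ` (boundary_edges A (prefix_core C) \<times> insert [] C)"
    using 1 eq by (intro image_eqI[of _ _ "((u, a), v)"]) auto
qed

lemma card_irreducibles:
  assumes "finite A" "card A \<ge> 2" "T \<subseteq> lists A - {[]}"
    and C: "C = lists A - {[]} - T" "finite C" "card C = n"
  shows "finite (irreducibles (@) T)"
    and "card (irreducibles (@) T) \<le> (card A - 1) * (n + 1) * (n + 2)"
proof -
  let ?F = "prefix_core C" and ?E = "insert [] C"
  let ?B = "boundary_edges A ?F"
  have sub: "?F \<subseteq> ?E" by (rule prefix_core_subset)
  have E: "finite ?E" "card ?E = n + 1" using C by auto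
  have F: "finite ?F" "card ?F \<le> n + 1"
    using finite_subset[OF sub] card_mono[OF _ sub] E by auto
  have B: "finite ?B" by (rule finite_boundary_edges[OF assms(1) F(1)])
  have "?F \<subseteq> lists A" using sub C by auto
  then have "card ?B + card ?F \<le> card A * card ?F + 1"
    using assms(1) F(1) Nil_in_prefix_core
    by (intro card_boundary_edges) (auto simp: snoc_in_prefix_core_iff)
  moreover obtain s where s: "card A = Suc s" "s \<ge> 1"
    using assms(2) by (cases "card A") auto
  ultimately have "card ?B \<le> s * card ?F + 1" by simp
  \<comment> \<open>Having at least two letters gives \<open>s \<ge> 1\<close>, so the summand 1 is
    absorbed into \<open>s\<close> and the bound becomes a product.\<close>
  also have "\<dots> \<le> s * (n + 1) + s"
    using mult_le_mono2[OF F(2), of s] s(2) by linarith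
  finally have cB: "card ?B \<le> s * (n + 2)" by (simp add: algebra_simps)
  note irr = irreducibles_subset[OF assms(3) C(1)]
  have fin: "finite (?B \<times> ?E)" using B E(1) by blast
  show "finite (irreducibles (@) T)" using finite_subset[OF irr] fin by blast
  have "card (irreducibles (@) T) \<le> card (?B \<times> ?E)" by (rule surj_card_le[OF fin irr])
  also have "\<dots> = card ?B * (n + 1)" using E(2) by (simp add: card_cartesian_product)
  also have "\<dots> \<le> s * (n + 2) * (n + 1)" by (rule mult_le_mono1[OF cB])
  finally show "card (irreducibles (@) T) \<le> (card A - 1) * (n + 1) * (n + 2)"
    using s(1) by (simp add: algebra_simps)
qed

lemma subsemigroups_of_index_Suc_subset:
  defines "S r \<equiv> free_semigroup r"
  shows "subsemigroups_of_index (@) (S r) (Suc n) \<subseteq>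
    (\<Union>T\<in>subsemigroups_of_index (@) (S r) n. (\<lambda>w. T - {w}) ` irreducibles (@) T)"
proof
  fix T assume "T \<in> subsemigroups_of_index (@) (S r) (Suc n)"
  then have T: "T \<subseteq> S r" "T \<noteq> {}" "\<And>x y. x \<in> T \<Longrightarrow> y \<in> T \<Longrightarrow> x @ y \<in> T"
    and fin: "finite (S r - T)" and card: "card (S r - T) = Suc n"
    by (auto simp: subsemigroups_of_index_def subsemigroup_def)
  have "S r - T \<noteq> {}" using card by (intro notI) simp
  with fin have "Max (length ` (S r - T)) \<in> length ` (S r - T)" by (intro Max_in) auto
  then obtain w where w: "w \<in> S r - T" and "length w = Max (length ` (S r - T))" by auto
  with fin have max: "length x \<le> length w" if "x \<in> S r - T" for x using that by simp
  have S: "x \<noteq> []" "x @ y \<in> S r" if "x \<in> S r" "y \<in> S r" for x y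
    using that by (auto simp: S_def free_semigroup_def)
  let ?T = "insert w T"
  have sub: "?T \<subseteq> S r" using w T by auto
  have "x @ y \<in> ?T" if xy: "x \<in> ?T" "y \<in> ?T" for x y
  proof (cases "x \<in> T \<and> y \<in> T")
    case False
    have "x \<in> S r" "y \<in> S r" using xy sub by auto
    \<comment> \<open>One factor is \<open>w\<close> and the other is nonempty, so the product is
      too long to lie in the complement of \<open>T\<close>.\<close>
    moreover from this have "length (x @ y) > length w"
      using False xy S[of x x] S[of y y] by auto
    ultimately show ?thesis using S(2) max[of "x @ y"] by fastforce
  qed (use T in auto)
  moreover have "S r - ?T = S r - T - {w}" by auto
  ultimately have 1: "?T \<in> subsemigroups_of_index (@) (S r) n"
    using sub fin card w by (simp add: subsemigroups_of_index_def subsemigroup_def)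
  have "w \<noteq> x @ y" if xy: "x \<in> ?T" "y \<in> ?T" for x y
  proof
    assume eq: "w = x @ y"
    \<comment> \<open>Both factors are then shorter than \<open>w\<close>, so neither of them is
      \<open>w\<close>.\<close>
    have "x \<noteq> []" "y \<noteq> []" using xy sub S(1) by blast+
    then have "x \<in> T" "y \<in> T" using xy eq by auto
    then show False using T(3) eq w by auto
  qed
  then have "w \<in> irreducibles (@) ?T" by (auto simp: irreducibles_def)
  moreover have "T = ?T - {w}" using w by auto
  ultimately show "T \<in> (\<Union>T\<in>subsemigroups_of_index (@) (S r) n.
      (\<lambda>w. T - {w}) ` irreducibles (@) T)"
    using 1 by blast
qed

lemma subsemigroups_of_index_0:
  "subsemigroups_of_index f S 0 \<subseteq> {S}"
  by (auto simp: subsemigroups_of_index_def subsemigroup_def)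

theorem theorem4p6:
  fixes r n :: nat
  assumes "r \<ge> 2" and "n \<ge> 1"
  shows "finite (subsemigroups_of_index (@) (free_semigroup r) n) \<and>
         num_subsemigroups_of_index (@) (free_semigroup r) n \<le> (r - 1) ^ n * (n + 1) * (fact n)\<^sup>2"
proof -
  let ?X = "subsemigroups_of_index (@) (free_semigroup r)"
  \<comment> \<open>Finiteness is carried through the induction because the union over
    \<open>?X n\<close> is bounded by a finite sum.\<close>
  have "finite (?X n) \<and> card (?X n) \<le> (r - 1) ^ n * (n + 1) * (fact n)\<^sup>2" for n
  proof (induction n)
    case 0
    show ?case
      using finite_subset[OF subsemigroups_of_index_0[of "(@)" "free_semigroup r"]]
        card_mono[OF _ subsemigroups_of_index_0[of "(@)" "free_semigroup r"]] by simp
  next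
    case (Suc n)
    let ?c = "(r - 1) * (n + 1) * (n + 2)"
    let ?R = "\<lambda>T. (\<lambda>w. T - {w}) ` irreducibles (@) T"
    have R: "finite (?R T)" "card (?R T) \<le> ?c" if "T \<in> ?X n" for T
    proof -
      have "T \<subseteq> lists {..<r} - {[]}" "finite (lists {..<r} - {[]} - T)"
        "card (lists {..<r} - {[]} - T) = n"
        using that by (auto simp: subsemigroups_of_index_def subsemigroup_def free_semigroup_def)
      then have *: "finite (irreducibles (@) T)" "card (irreducibles (@) T) \<le> ?c"
        using card_irreducibles[of "{..<r}" T] assms(1) by auto
      show "finite (?R T)" using *(1) by simp
      show "card (?R T) \<le> ?c" using card_image_le[OF *(1)] *(2) by (rule order_trans)
    qed
    have fin: "finite (\<Union>T\<in>?X n. ?R T)" using Suc R(1) by blast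
    note sub = subsemigroups_of_index_Suc_subset[of r n]
    have "card (?X (Suc n)) \<le> card (\<Union>T\<in>?X n. ?R T)" by (rule card_mono[OF fin sub])
    also have "\<dots> \<le> (\<Sum>T\<in>?X n. card (?R T))" using Suc by (intro card_UN_le) auto
    also have "\<dots> \<le> card (?X n) * ?c" using sum_bounded_above[of "?X n" _ ?c] R(2) by simp
    also have "\<dots> \<le> (r - 1) ^ n * (n + 1) * (fact n)\<^sup>2 * ?c"
      using Suc by (intro mult_le_mono1) auto
    \<comment> \<open>The old factor \<open>n + 1\<close> and the one in \<open>?c\<close> together
      turn the square of \<open>fact n\<close> into that of \<open>fact (Suc n)\<close>; the factor
      \<open>n + 2\<close> of \<open>?c\<close> is the new \<open>Suc n + 1\<close>.\<close>
    also have "\<dots> = (r - 1) ^ Suc n * (Suc n + 1) * (fact (Suc n))\<^sup>2"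
      by (simp add: power2_eq_square algebra_simps)
    finally show ?case using finite_subset[OF sub fin] by blast
  qed
  then show ?thesis by (simp add: num_subsemigroups_of_index_def)
qed

end
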